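(* Let $n \ge 1$ and $k \ge 2$ be natural numbers, and let $a_{ij}$ ($1 \le i \le n$, $2 \le j \le k$) be natural numbers (positive integers). For a natural number $N$ let $R_k^+(N)$ denote the number of tuples of natural numbers $(x_1,\dots,x_k)$ with $1 \le x_j \le N$ for all $j$ satisfying $$x_1 = a_{n2}x_2^n + \dots + a_{12}x_2 + \dots + a_{nk}x_k^n + \dots + a_{1k}x_k,$$ i.e. $x_1 = \sum_{j=2}^{k}\sum_{i=1}^{n} a_{ij} x_j^i$. Then $$R_k^+(N) \ll N^{(k-1)/n}.$$
   Context: Natural numbers are positive integers. The notation $g(N) \ll h(N)$ means there is a constant $C>0$, independent of $N$ (it may depend on $n$, $k$ and the coefficients), such that $g(N) \le C\,h(N)$ for all natural $N$. *)

theory Defs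
  imports Complex_Main "HOL-Library.FuncSet"
begin

(* A tuple (x_1, ..., x_k) is an extensional function on {1..k}, so that distinct
   functions are distinct tuples. The coefficient a_{ij} is written "a i j". *)
definition solutions_plus :: "nat \<Rightarrow> nat \<Rightarrow> (nat \<Rightarrow> nat \<Rightarrow> nat) \<Rightarrow> nat \<Rightarrow> (nat \<Rightarrow> nat) set" where
  "solutions_plus n k a N =
     {x \<in> {1..k} \<rightarrow>\<^sub>E {1..N}. x 1 = (\<Sum>j=2..k. \<Sum>i=1..n. a i j * x j ^ i)}"

definition R_plus :: "nat \<Rightarrow> nat \<Rightarrow> (nat \<Rightarrow> nat \<Rightarrow> nat) \<Rightarrow> nat \<Rightarrow> nat" where
  "R_plus n k a N = card (solutions_plus n k a N)"

end

theory Submission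
  imports Defs
begin

text \<open>All terms on the right of the equation are nonnegative and the sum is x_1 \<le> N, so
  each single term a_{nj} x_j^n is at most N; as a_{nj} \<ge> 1, this gives x_j \<le> N^(1/n) for j
  \<ge> 2 (\<open>solutions_plus_power_le\<close>). The equation makes x_1 a function of the other
  coordinates (\<open>inj_on_restrict_solutions_plus\<close>), so solutions are counted by their
  tails (x_2, ..., x_k), which lie in a box with k - 1 sides of length at most N^(1/n)
  (\<open>R_plus_le_power\<close>).\<close>

lemma solutions_plus_power_le:
  assumes "x \<in> solutions_plus n k a N" "n \<ge> 1" "j \<in> {2..k}" "a n j \<ge> 1"
  shows "x j ^ n \<le> N"
proof -
  have x: "x \<in> {1..k} \<rightarrow>\<^sub>E {1..N}"
    and eq: "x 1 = (\<Sum>j=2..k. \<Sum>i=1..n. a i j * x j ^ i)"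
    using assms(1) by (auto simp: solutions_plus_def)
  have "x j ^ n \<le> a n j * x j ^ n"
    using assms(4) by simp
  also have "\<dots> \<le> (\<Sum>i=1..n. a i j * x j ^ i)"
    using assms(2) by (intro member_le_sum) auto
  also have "\<dots> \<le> (\<Sum>j=2..k. \<Sum>i=1..n. a i j * x j ^ i)"
    using assms(3) by (intro member_le_sum[where f = "\<lambda>j. \<Sum>i=1..n. a i j * x j ^ i"]) auto
  also have "\<dots> \<le> N"
    using PiE_mem[OF x, of 1] assms(3) unfolding eq[symmetric] by auto
  finally show ?thesis .
qed

text \<open>The right side of the equation involves only the coordinates from 2 to k, so equal tails
  force equal values of \<open>x 1\<close>. Extensionality settles the arguments outside
  \<open>{1..k}\<close>.\<close>

lemma inj_on_restrict_solutions_plus: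
  "inj_on (\<lambda>x. restrict x {2..k}) (solutions_plus n k a N)"
proof (rule inj_onI)
  fix x y
  assume x: "x \<in> solutions_plus n k a N" and y: "y \<in> solutions_plus n k a N"
    and "restrict x {2..k} = restrict y {2..k}"
  then have tail: "x j = y j" if "j \<in> {2..k}" for j
    using that by (metis restrict_apply')
  have "x 1 = y 1"
    using x y tail by (simp add: solutions_plus_def)
  then have "x j = y j" if "j \<in> {1..k}" for j
    using that tail[of j] by (cases "j = 1") auto
  then show "x = y"
    using x y by (intro PiE_ext[of x "{1..k}" "\<lambda>_. {1..N}" y]) (auto simp: solutions_plus_def)
qed

text \<open>Restriction embeds the solutions into the box
  \<open>{2..k} \<rightarrow>\<^sub>E {1..M}\<close>, which has k - 1 coordinates with M choices
  each.\<close>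

lemma R_plus_le_power:
  assumes "\<And>x j. x \<in> solutions_plus n k a N \<Longrightarrow> j \<in> {2..k} \<Longrightarrow> x j \<le> M"
  shows "R_plus n k a N \<le> M ^ (k - 1)"
proof -
  have "(\<lambda>x. restrict x {2..k}) ` solutions_plus n k a N \<subseteq> {2..k} \<rightarrow>\<^sub>E {1..M}"
  proof (intro image_subsetI PiE_I)
    fix x j assume x: "x \<in> solutions_plus n k a N" and j: "j \<in> {2..k}"
    have "x \<in> {1..k} \<rightarrow>\<^sub>E {1..N}"
      using x by (simp add: solutions_plus_def)
    then have "1 \<le> x j"
      using PiE_mem[of x "{1..k}" "\<lambda>_. {1..N}" j] j by auto
    then show "restrict x {2..k} j \<in> {1..M}"
      using assms[OF x j] j by simp
  qed auto
  then have "R_plus n k a N \<le> card ({2..k} \<rightarrow>\<^sub>E {1..M})"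
    unfolding R_plus_def
    by (intro card_inj_on_le[OF inj_on_restrict_solutions_plus]) (auto intro: finite_PiE)
  then show ?thesis
    by (simp add: card_PiE)
qed

theorem mainTheorem1:
  fixes n k :: nat and a :: "nat \<Rightarrow> nat \<Rightarrow> nat"
  assumes "n \<ge> 1" and "k \<ge> 2"
    and "\<And>i j. i \<in> {1..n} \<Longrightarrow> j \<in> {2..k} \<Longrightarrow> a i j \<ge> 1"
  shows "\<exists>C::real. C > 0 \<and>
    (\<forall>N::nat. N \<ge> 1 \<longrightarrow> real (R_plus n k a N) \<le> C * real N powr ((real k - 1) / real n))"
\<comment> \<open>The bound on each x_j carries no constant, so C = 1 serves for all n, k and
  coefficients.\<close>
proof (intro exI[of _ 1] conjI allI impI)
  fix N :: nat assume N: "N \<ge> 1"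
  define r where "r = real N powr (1 / real n)"
  \<comment> \<open>Counting needs an integer side length. Rounding the root down loses no solution,
    since each x_j is an integer, and keeps M \<le> r for the final estimate.\<close>
  define M where "M = nat \<lfloor>r\<rfloor>"
  have "x j \<le> M" if x: "x \<in> solutions_plus n k a N" and j: "j \<in> {2..k}" for x j
  proof -
    have "x j ^ n \<le> N"
      using solutions_plus_power_le[OF x _ j] assms(1) assms(3)[of n j] j by simp
    then have "real (x j) ^ n \<le> real N"
      by (metis of_nat_le_iff of_nat_power)
    also have "real N = r ^ n"
      using N assms(1) by (simp add: r_def powr_power)
    finally have "real (x j) \<le> r"
      using assms(1) by (simp add: r_def power_mono_iff)
    then show ?thesis
      by (simp add: M_def le_nat_floor)
  qed
  then have "real (R_plus n k a N) \<le> real (M ^ (k - 1))"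
    by (simp only: of_nat_le_iff R_plus_le_power)
  also have "\<dots> \<le> r ^ (k - 1)"
    by (simp add: M_def r_def power_mono)
  also have "\<dots> = real N powr ((real k - 1) / real n)"
    using N assms(2) by (simp add: r_def powr_power of_nat_diff)
  finally show "real (R_plus n k a N) \<le> 1 * real N powr ((real k - 1) / real n)"
    by simp
qed simp

end
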